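(* Let $B\in\mathbb R$ and let $F_i:\overline{I_i}\times\mathbb R\times\mathbb R\to\mathbb R$ be continuous for each $i\in\{1,\dots,K\}$. A lower semi-continuous function $v:\mathcal I\to\mathbb R$ is a viscosity super-solution of $$F_i(x,v,v_{x_i})=0\ \text{ in }I_i\ (i=1,\dots,K),\qquad\sum_{i=1}^Kv_{x_i}=B\ \text{ on }\{0\}$$ if and only if for each $\varphi\in C^2(\mathcal I)$ and any local minimum $x_0$ of $v-\varphi$ the following inequalities are satisfied: $$F_i(x_0,v(x_0),\varphi_{x_i}(x_0))\ge0\quad\text{if }x_0\in I_i,$$ $$\max_{1\le i\le K,\ \tilde\theta\in[0,1]}F_i\Big(0,v(0),\varphi_{x_i}(0)-\tilde\theta\Big(\sum_{j=1}^K\varphi_{x_j}(0)-B\Big)^+\Big)\ge0\quad\text{if }x_0=0.$$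
   Context: Junction: fix an integer $K\ge1$ and $K$ copies $I_1,\dots,I_K$ of $(-\infty,0)$. $\mathcal I=\bigcup_i\overline{I_i}$ is the union of the half-lines $\overline{I_i}=(-\infty,0]$ glued at $0$, with metric $d(x,y)=|x-y|$ on a common edge and $|x|+|y|$ otherwise. $\varphi_{x_i}$ is the derivative along $\overline{I_i}$ (one-sided at $0$). $C^2(\mathcal I)$: continuous functions on $\mathcal I$ whose restriction to each $\overline{I_i}$ is $C^2$ (derivatives at $0$ along different edges may differ). $a^+=\max\{a,0\}$. A lower semi-continuous $v:\mathcal I\to\mathbb R$ is a super-solution if whenever $\varphi\in C^2(\mathcal I)$ and $v-\varphi$ has a local minimum at $x_0\in\mathcal I$: $F_i(x_0,v(x_0),\varphi_{x_i}(x_0))\ge0$ if $x_0\in I_i$, and $\max\{\sum_{i=1}^K\varphi_{x_i}(0)-B,\ \max_iF_i(0,v(0),\varphi_{x_i}(0))\}\ge0$ if $x_0=0$. *)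

theory Defs
  imports "HOL-Analysis.Analysis"
begin

section \<open>The junction\<close>

text \<open>
  The number of edges is \<open>K = CARD('k)\<close> for a finite index type \<open>'k\<close>, so \<open>K \<ge> 1\<close> holds
  automatically.  The junction is the quotient of \<open>'k \<times> (-\<infinity>, 0]\<close> that identifies all the end
  points \<open>(i, 0)\<close>.
\<close>

definition glue :: "'k \<times> real \<Rightarrow> 'k \<times> real \<Rightarrow> bool" where
  "glue p q \<longleftrightarrow> snd p \<le> 0 \<and> snd p = snd q \<and> (fst p = fst q \<or> snd p = 0)"

lemma part_equivp_glue: "part_equivp (glue :: 'k \<times> real \<Rightarrow> 'k \<times> real \<Rightarrow> bool)"
proof (rule part_equivpI)
  show "\<exists>p::'k \<times> real. glue p p"
    by (rule exI[of _ "(undefined, 0)"]) (simp add: glue_def)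
  show "symp (glue :: 'k \<times> real \<Rightarrow> 'k \<times> real \<Rightarrow> bool)"
    by (auto simp: symp_def glue_def)
  show "transp (glue :: 'k \<times> real \<Rightarrow> 'k \<times> real \<Rightarrow> bool)"
    by (auto simp: transp_def glue_def)
qed

quotient_type 'k junction = "'k \<times> real" / partial: glue
  by (rule part_equivp_glue)

text \<open>
  \<open>edge i x\<close> is the point of coordinate \<open>x\<close> on the \<open>i\<close>-th closed edge.  It is meant for
  \<open>x \<le> 0\<close>; positive arguments are sent to the vertex only to make the function total.
\<close>

lift_definition edge :: "'k \<Rightarrow> real \<Rightarrow> 'k junction" is "\<lambda>i x. (i, min x 0)"
  by (simp add: glue_def)

definition vertex :: "'k junction" where
  "vertex = edge undefined 0"

lemma edge_0 [simp]: "edge i 0 = vertex"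
  unfolding vertex_def by transfer (simp add: glue_def)

lemma edge_eq_iff:
  assumes "x \<le> 0" "y \<le> 0"
  shows "edge i x = edge j y \<longleftrightarrow> x = y \<and> (i = j \<or> x = 0)"
  using assms by transfer (auto simp: glue_def)

lemma edge_cases:
  obtains i x where "x \<le> 0" "p = edge i x"
proof -
  have "\<exists>i x. x \<le> 0 \<and> p = edge i x"
    by transfer (force simp: glue_def)
  then show ?thesis
    using that by blast
qed

instantiation junction :: (type) metric_space
begin

lift_definition dist_junction :: "'a junction \<Rightarrow> 'a junction \<Rightarrow> real" is
  "\<lambda>p q. if fst p = fst q then \<bar>snd p - snd q\<bar> else \<bar>snd p\<bar> + \<bar>snd q\<bar>"
  by (auto simp: glue_def)

definition uniformity_junction :: "('a junction \<times> 'a junction) filter" where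
  "uniformity_junction = (INF e\<in>{0 <..}. principal {(p, q). dist p q < e})"

definition open_junction :: "'a junction set \<Rightarrow> bool" where
  "open_junction U \<longleftrightarrow> (\<forall>p\<in>U. \<forall>\<^sub>F (p', q) in uniformity. p' = p \<longrightarrow> q \<in> U)"

instance
proof
  fix p q r :: "'a junction"
  show "dist p q = 0 \<longleftrightarrow> p = q"
    by transfer (auto simp: glue_def split: if_splits)
  show "dist p q \<le> dist p r + dist q r"
    by transfer (auto simp: glue_def)
qed (simp_all add: uniformity_junction_def open_junction_def)

end

lemma dist_edge:
  assumes "x \<le> 0" "y \<le> 0"
  shows "dist (edge i x) (edge j y) = (if i = j then \<bar>x - y\<bar> else \<bar>x\<bar> + \<bar>y\<bar>)"
  using assms by transfer simp


section \<open>Test functions\<close>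

text \<open>
  On the closed half-line \<open>{..0}\<close> all derivatives are taken within \<open>{..0}\<close>, hence they are
  one-sided (from the left) at \<open>0\<close>.
\<close>

definition C2_halfline :: "(real \<Rightarrow> real) \<Rightarrow> bool" where
  "C2_halfline f \<longleftrightarrow> (\<exists>f' f''.
     (\<forall>x\<le>0. (f has_real_derivative f' x) (at x within {..0})) \<and>
     (\<forall>x\<le>0. (f' has_real_derivative f'' x) (at x within {..0})) \<and>
     continuous_on {..0} f'')"

definition C2_junction :: "('k junction \<Rightarrow> real) \<Rightarrow> bool" where
  "C2_junction \<phi> \<longleftrightarrow> continuous_on UNIV \<phi> \<and> (\<forall>i. C2_halfline (\<lambda>x. \<phi> (edge i x)))"

definition edge_deriv :: "('k junction \<Rightarrow> real) \<Rightarrow> 'k \<Rightarrow> real \<Rightarrow> real" where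
  "edge_deriv \<phi> i x = vector_derivative (\<lambda>t. \<phi> (edge i t)) (at x within {..0})"

lemma edge_deriv_unique:
  assumes "x \<le> 0" "((\<lambda>t. \<phi> (edge i t)) has_real_derivative d) (at x within {..0})"
  shows "edge_deriv \<phi> i x = d"
proof -
  have "at x within {..0} \<noteq> bot"
  proof -
    have "x islimpt {..x}"
    proof (rule islimpt_subset)
      show "x islimpt {x - 1<..<x}"
        by (simp add: islimpt_greaterThanLessThan2)
    qed auto
    then have "x islimpt {..0}"
      by (rule islimpt_subset) (use assms(1) in auto)
    then show ?thesis
      by (simp add: trivial_limit_within)
  qed
  then show ?thesis
    unfolding edge_deriv_def using assms(2)
    by (intro vector_derivative_within)
      (auto simp: has_real_derivative_iff_has_vector_derivative)
qed


section \<open>Viscosity super-solutions\<close>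

definition lower_semicontinuous :: "('a::topological_space \<Rightarrow> real) \<Rightarrow> bool" where
  "lower_semicontinuous v \<longleftrightarrow> (\<forall>x. \<forall>a < v x. \<forall>\<^sub>F y in nhds x. a < v y)"

definition local_min :: "('a::topological_space \<Rightarrow> real) \<Rightarrow> 'a \<Rightarrow> bool" where
  "local_min f x \<longleftrightarrow> (\<forall>\<^sub>F y in nhds x. f x \<le> f y)"

definition viscosity_supersolution ::
  "('k::finite \<Rightarrow> real \<Rightarrow> real \<Rightarrow> real \<Rightarrow> real) \<Rightarrow> real \<Rightarrow> ('k junction \<Rightarrow> real) \<Rightarrow> bool" where
  "viscosity_supersolution F B v \<longleftrightarrow> lower_semicontinuous v \<and>
     (\<forall>\<phi> x\<^sub>0. C2_junction \<phi> \<longrightarrow> local_min (\<lambda>x. v x - \<phi> x) x\<^sub>0 \<longrightarrow>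
        (\<forall>i x. x < 0 \<longrightarrow> x\<^sub>0 = edge i x \<longrightarrow> F i x (v x\<^sub>0) (edge_deriv \<phi> i x) \<ge> 0) \<and>
        (x\<^sub>0 = vertex \<longrightarrow>
           max ((\<Sum>i\<in>UNIV. edge_deriv \<phi> i 0) - B)
               (MAX i. F i 0 (v vertex) (edge_deriv \<phi> i 0)) \<ge> 0))"

text \<open>
  For continuous data the supremum over \<open>i\<close> and \<open>\<theta> \<in> [0, 1]\<close> is attained: it is the maximum.
\<close>

lemma SUP_attained:
  fixes F :: "'k::finite \<Rightarrow> real \<Rightarrow> real \<Rightarrow> real \<Rightarrow> real" and p :: "'k \<Rightarrow> real" and u s :: real
  assumes "\<And>i. continuous_on ({..0} \<times> UNIV \<times> UNIV) (\<lambda>(x, u, p). F i x u p)"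
  defines "G \<equiv> \<lambda>(i, \<theta>). F i 0 u (p i - \<theta> * s)"
  shows "\<exists>z \<in> UNIV \<times> {0..1::real}. G z = (SUP z \<in> UNIV \<times> {0..1}. G z) \<and>
           (\<forall>z' \<in> UNIV \<times> {0..1}. G z' \<le> G z)"
proof -
  have "\<exists>\<theta>\<in>{0..1}. \<forall>\<theta>'\<in>{0..1}. G (i, \<theta>') \<le> G (i, \<theta>)" for i
  proof (rule continuous_attains_sup)
    have "continuous_on {0..1} ((\<lambda>(x, u, p). F i x u p) \<circ> (\<lambda>\<theta>. (0, u, p i - \<theta> * s)))"
      by (rule continuous_on_compose, intro continuous_intros,
          rule continuous_on_subset[OF assms(1)]) auto
    then show "continuous_on {0..1} (\<lambda>\<theta>. G (i, \<theta>))"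
      by (simp add: G_def comp_def)
  qed auto
  then obtain t where t: "\<And>i. t i \<in> {0..1}" "\<And>i \<theta>'. \<theta>' \<in> {0..1} \<Longrightarrow> G (i, \<theta>') \<le> G (i, t i)"
    by metis
  define m where "m = (MAX i. G (i, t i))"
  have "m \<in> range (\<lambda>i. G (i, t i))"
    unfolding m_def by (rule Max_in) auto
  then obtain j where j: "m = G (j, t j)"
    by auto
  have le: "G z \<le> G (j, t j)" if zin: "z \<in> UNIV \<times> {0..1}" for z
  proof -
    obtain i \<theta> where z: "z = (i, \<theta>)" "\<theta> \<in> {0..1}"
      using zin by auto
    have "G (i, t i) \<le> m"
      unfolding m_def by (rule Max_ge) auto
    with t(2)[OF z(2), of i] show ?thesis
      by (simp add: z(1) j)
  qed
  have "(SUP z \<in> UNIV \<times> {0..1}. G z) = G (j, t j)"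
    by (rule cSup_eq_maximum) (use le t(1) in \<open>auto simp del: atLeastAtMost_iff\<close>)
  with le t(1)[of j] show ?thesis
    by (intro bexI[of _ "(j, t j)"]) auto
qed

end

theory Submission
  imports Defs
begin

text \<open>
  Write \<open>p i\<close> for the slopes of a test function at the vertex and \<open>s\<close> for the positive part of
  \<open>(\<Sum>i. p i) - B\<close>.  The relaxed condition implies the Kirchhoff one by cases: either the sum of the
  slopes is at least \<open>B\<close>, or \<open>s = 0\<close> and the parameter \<open>\<theta>\<close> has no influence.

  For the converse, suppose that the relaxed condition fails: \<open>F i 0 (v vertex)\<close> is negative on the
  whole interval from \<open>p i - s\<close> to \<open>p i\<close>, for every \<open>i\<close>.  Lowering the slope of a test function on
  an edge raises it there, since the coordinates are negative, so in general it stops touching \<open>v\<close>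
  from below.  There is a critical slope beyond which the lowering must not go.  At the critical
  slope the equation in the interior of the edge passes to the limit: parabolas whose slopes are
  all close to the critical one touch \<open>v\<close> from below at interior points arbitrarily close to the
  vertex, so \<open>F i 0 (v vertex)\<close> cannot be negative there (\<open>support_slope_improves\<close>).  Hence the
  critical slope lies strictly below \<open>p i - s\<close>
  (\<open>support_slope_below_negative_interval\<close>), and on one single edge the slope can be lowered by
  slightly more than \<open>s\<close> (\<open>replace_slope_at_vertex\<close>).  That already makes the sum of all slopes
  smaller than \<open>B\<close>, while \<open>F i\<close> stays negative at each of the new slopes: the new test function
  contradicts the Kirchhoff condition.
\<close>

section \<open>Semicontinuous functions\<close>

lemma continuous_on_UNIV_iff_tendsto_nhds:
  "continuous_on UNIV f \<longleftrightarrow> (\<forall>x. (f \<longlongrightarrow> f x) (nhds x))"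
  by (simp add: continuous_on_def tendsto_at_iff_tendsto_nhds)

lemma lower_semicontinuous_compose:
  assumes "lower_semicontinuous v" "continuous_on UNIV f"
  shows "lower_semicontinuous (\<lambda>x. v (f x))"
  unfolding lower_semicontinuous_def
proof (intro allI impI)
  fix x a assume "a < v (f x)"
  then have ev: "\<forall>\<^sub>F y in nhds (f x). a < v y"
    using assms(1) by (simp add: lower_semicontinuous_def)
  have "filterlim f (nhds (f x)) (nhds x)"
    using assms(2) by (simp add: continuous_on_UNIV_iff_tendsto_nhds)
  then show "\<forall>\<^sub>F y in nhds x. a < v (f y)"
    by (rule eventually_compose_filterlim[OF ev])
qed

lemma lower_semicontinuous_diff_continuous:
  fixes f g :: "'a::topological_space \<Rightarrow> real"
  assumes "lower_semicontinuous f" "continuous_on UNIV g"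
  shows "lower_semicontinuous (\<lambda>x. f x - g x)"
  unfolding lower_semicontinuous_def
proof (intro allI impI)
  fix x a assume a: "a < f x - g x"
  define e where "e = (f x - g x - a) / 2"
  have e: "e > 0" using a by (simp add: e_def)
  have "\<forall>\<^sub>F y in nhds x. f x - e < f y"
    using assms(1) e by (simp add: lower_semicontinuous_def)
  moreover have "(g \<longlongrightarrow> g x) (nhds x)"
    using assms(2) by (simp add: continuous_on_UNIV_iff_tendsto_nhds)
  then have "\<forall>\<^sub>F y in nhds x. g y < g x + e"
    by (rule order_tendstoD) (use e in simp)
  ultimately show "\<forall>\<^sub>F y in nhds x. a < f y - g y"
    by eventually_elim (simp add: e_def field_simps)
qed

text \<open>
  If no minimum were attained, the open superlevel sets of the values taken on \<open>S\<close> would cover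
  \<open>S\<close>; the least of the finitely many values of a subcover would then exceed another one.
\<close>

lemma lower_semicontinuous_attains_inf:
  fixes f :: "'a::topological_space \<Rightarrow> real"
  assumes "lower_semicontinuous f" "compact S" "S \<noteq> {}"
  shows "\<exists>x\<in>S. \<forall>y\<in>S. f x \<le> f y"
proof (rule ccontr)
  assume "\<not> ?thesis"
  then have less: "\<And>x. x \<in> S \<Longrightarrow> \<exists>y\<in>S. f y < f x"
    by (meson not_le)
  have "open {x. f y < f x}" for y
  proof (subst open_subopen, rule ballI)
    fix x assume "x \<in> {x. f y < f x}"
    then obtain T where "open T" "x \<in> T" "\<forall>z\<in>T. f y < f z"
      using assms(1) unfolding lower_semicontinuous_def eventually_nhds by simp meson
    then show "\<exists>T. open T \<and> x \<in> T \<and> T \<subseteq> {x. f y < f x}"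
      by blast
  qed
  moreover have "S \<subseteq> (\<Union>y\<in>S. {x. f y < f x})"
    using less by auto
  ultimately obtain D where D: "D \<subseteq> S" "finite D" "S \<subseteq> (\<Union>y\<in>D. {x. f y < f x})"
    using compactE_image[OF assms(2), of S "\<lambda>y. {x. f y < f x}"] by metis
  have "D \<noteq> {}"
    using D(3) assms(3) by auto
  then obtain z where z: "z \<in> D" "\<And>y. y \<in> D \<Longrightarrow> f z \<le> f y"
    using D(2) by (metis arg_min_if_finite(1) arg_min_least)
  then show False
    using D(1,3) by force
qed


section \<open>Neighbourhoods and test functions on the junction\<close>

lemma continuous_on_edge: "continuous_on UNIV (edge i)"
proof -
  have "dist (edge i x) (edge i y) \<le> dist x y" for x y
    by transfer (auto simp: dist_real_def min_def)
  then show ?thesis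
    unfolding continuous_on_iff by (meson le_less_trans)
qed

lemma eventually_nhds_edgeD:
  assumes "\<forall>\<^sub>F p in nhds (edge i x). P p"
  shows "\<forall>\<^sub>F t in nhds x. P (edge i t)"
proof -
  have "filterlim (edge i) (nhds (edge i x)) (nhds x)"
    using continuous_on_edge[of i] by (simp add: continuous_on_UNIV_iff_tendsto_nhds)
  then show ?thesis
    by (rule eventually_compose_filterlim[OF assms])
qed

lemma eventually_nhds_edge_interior:
  assumes "x < 0"
  shows "(\<forall>\<^sub>F p in nhds (edge i x). P p) \<longleftrightarrow> (\<forall>\<^sub>F t in nhds x. P (edge i t))"
proof
  assume "\<forall>\<^sub>F t in nhds x. P (edge i t)"
  then obtain d where d: "d > 0" "\<And>t. dist t x < d \<Longrightarrow> P (edge i t)"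
    by (auto simp: eventually_nhds_metric)
  have "P p" if p: "dist p (edge i x) < min d (- x)" for p
  proof -
    obtain j t where t: "t \<le> 0" "p = edge j t" by (rule edge_cases)
    have "j = i" "dist t x < d"
      using p t assms by (auto simp: dist_edge dist_real_def split: if_splits)
    then show ?thesis
      using d(2) t(2) by simp
  qed
  moreover have "min d (- x) > 0"
    using d(1) assms by simp
  ultimately show "\<forall>\<^sub>F p in nhds (edge i x). P p"
    unfolding eventually_nhds_metric by blast
qed (rule eventually_nhds_edgeD)

lemma eventually_nhds_vertex:
  fixes P :: "'k::finite junction \<Rightarrow> bool"
  shows "(\<forall>\<^sub>F p in nhds vertex. P p) \<longleftrightarrow>
    P vertex \<and> (\<forall>i. \<forall>\<^sub>F t in at_left 0. P (edge i t))"
proof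
  assume ev: "\<forall>\<^sub>F p in nhds vertex. P p"
  have "\<forall>\<^sub>F t in nhds 0. P (edge i t)" for i
    by (rule eventually_nhds_edgeD) (simp add: ev)
  then show "P vertex \<and> (\<forall>i. \<forall>\<^sub>F t in at_left 0. P (edge i t))"
    using eventually_nhds_x_imp_x[OF ev]
    by (auto simp: eventually_at_filter intro: always_eventually eventually_mono)
next
  assume R: "P vertex \<and> (\<forall>i. \<forall>\<^sub>F t in at_left 0. P (edge i t))"
  then have "\<forall>i. \<exists>b<0. \<forall>y>b. y < 0 \<longrightarrow> P (edge i y)"
    unfolding eventually_at_left_field by auto
  then obtain b where b: "\<And>i. b i < 0" "\<And>i y. b i < y \<Longrightarrow> y < 0 \<Longrightarrow> P (edge i y)"
    by metis
  define d where "d = (MIN i. - b i)"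
  have "d \<in> range (\<lambda>i. - b i)"
    unfolding d_def by (rule Min_in) auto
  then have "d > 0"
    using b(1) by (auto simp: image_def)
  moreover have "P p" if p: "dist p vertex < d" for p
  proof -
    obtain j t where t: "t \<le> 0" "p = edge j t" by (rule edge_cases)
    have "\<bar>t\<bar> < d"
      using p t dist_edge[of t 0 j j] by simp
    moreover have "d \<le> - b j"
      unfolding d_def by (rule Min_le) auto
    ultimately show ?thesis
      using b(2)[of j t] t R by (cases "t = 0") auto
  qed
  ultimately show "\<forall>\<^sub>F p in nhds vertex. P p"
    unfolding eventually_nhds_metric by blast
qed

text \<open>
  Derivatives are taken within the half-line, so what \<open>edge\<close> does with positive arguments is
  invisible to them.
\<close>

lemma C2_halfline_cong:
  assumes "C2_halfline f" "\<And>x. x \<le> 0 \<Longrightarrow> f x = g x"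
  shows "C2_halfline g"
proof -
  obtain f' f'' where f: "\<forall>x\<le>0. (f has_real_derivative f' x) (at x within {..0})"
     "\<forall>x\<le>0. (f' has_real_derivative f'' x) (at x within {..0})" "continuous_on {..0} f''"
    using assms(1) unfolding C2_halfline_def by blast
  have "(g has_real_derivative f' x) (at x within {..0})" if "x \<le> 0" for x
    by (rule has_field_derivative_transform_within[of f _ x "{..0}" 1])
      (use f(1) that assms(2) in auto)
  then show ?thesis
    using f unfolding C2_halfline_def by blast
qed

lemma C2_halfline_quadratic: "C2_halfline (\<lambda>x. c + b * x + a * x\<^sup>2)"
  unfolding C2_halfline_def
  by (rule exI[of _ "\<lambda>x. b + 2 * a * x"], rule exI[of _ "\<lambda>x. 2 * a"])
    (auto intro!: derivative_eq_intros)

lemma C2_halfline_continuous_on: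
  assumes "C2_halfline f"
  shows "continuous_on {..0} f"
  using assms unfolding C2_halfline_def continuous_on_eq_continuous_within
  by (auto intro: DERIV_continuous)

lemma edge_deriv_has_derivative:
  assumes "C2_junction \<phi>" "x \<le> 0"
  shows "((\<lambda>t. \<phi> (edge i t)) has_real_derivative edge_deriv \<phi> i x) (at x within {..0})"
proof -
  obtain d where "((\<lambda>t. \<phi> (edge i t)) has_real_derivative d) (at x within {..0})"
    using assms unfolding C2_junction_def C2_halfline_def by metis
  with edge_deriv_unique[OF assms(2) this] show ?thesis by simp
qed

text \<open>
  A test function may be prescribed edge by edge: the pieces only have to agree at the vertex,
  since the derivatives there along different edges are independent of each other.
\<close>

lemma C2_junction_of_edges:
  fixes g :: "'k::finite \<Rightarrow> real \<Rightarrow> real"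
  assumes C2: "\<And>i. C2_halfline (g i)" and glue: "\<And>i. g i 0 = c"
  obtains \<psi> where "C2_junction \<psi>" "\<And>i x. x \<le> 0 \<Longrightarrow> \<psi> (edge i x) = g i x"
proof -
  define \<psi> where "\<psi> p = (THE y. \<exists>i x. x \<le> 0 \<and> p = edge i x \<and> y = g i x)" for p
  have \<psi>: "\<psi> (edge i x) = g i x" if "x \<le> 0" for i x
    unfolding \<psi>_def
  proof (rule the_equality)
    show "\<exists>j t. t \<le> 0 \<and> edge i x = edge j t \<and> g i x = g j t"
      using that by blast
  qed (use that glue in \<open>auto simp: edge_eq_iff\<close>)
  have "(\<psi> \<longlongrightarrow> \<psi> p) (nhds p)" for p
  proof -
    obtain i x where x: "x \<le> 0" "p = edge i x" by (rule edge_cases)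
    have lim: "(g j \<longlongrightarrow> g j t) (at t within {..0})" if "t \<le> 0" for j t
      using C2_halfline_continuous_on[OF C2] that by (simp add: continuous_on_def)
    show ?thesis
    proof (cases "x = 0")
      case False
      then have "x < 0" using x by simp
      have g_lim: "(g i \<longlongrightarrow> g i x) (nhds x)"
        using lim[OF x(1), of i] at_within_interior[of x "{..0}"] \<open>x < 0\<close>
        by (simp add: tendsto_at_iff_tendsto_nhds)
      have "\<forall>\<^sub>F t in nhds x. t \<in> {..<0}"
        using \<open>x < 0\<close> by (intro eventually_nhds_in_open) auto
      then have "\<forall>\<^sub>F t in nhds x. dist (\<psi> (edge i t)) (g i x) < e" if "e > 0" for e
        using tendstoD[OF g_lim that] by eventually_elim (simp add: \<psi>)
      then show ?thesis
        using \<open>x < 0\<close> by (auto intro!: tendstoI simp: x eventually_nhds_edge_interior \<psi>)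
    next
      case True
      have "\<forall>\<^sub>F t in at_left 0. dist (\<psi> (edge j t)) (g j 0) < e" if "e > 0" for e j
      proof -
        have "(g j \<longlongrightarrow> g j 0) (at_left 0)"
          by (rule tendsto_within_subset[OF lim]) auto
        then have "\<forall>\<^sub>F t in at_left 0. dist (g j t) (g j 0) < e"
          using that by (rule tendstoD)
        moreover have "\<forall>\<^sub>F t in at_left (0::real). t < 0"
          by (simp add: eventually_at_filter)
        ultimately show ?thesis
          by eventually_elim (simp add: \<psi>)
      qed
      moreover have "\<psi> vertex = c"
        using \<psi>[of 0 i] glue by simp
      ultimately show ?thesis
        using True by (auto intro!: tendstoI simp: x eventually_nhds_vertex glue)
    qed
  qed
  then have "continuous_on UNIV \<psi>"
    by (simp add: continuous_on_UNIV_iff_tendsto_nhds)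
  moreover have "C2_halfline (\<lambda>x. \<psi> (edge i x))" for i
    by (rule C2_halfline_cong[OF C2]) (simp add: \<psi>)
  ultimately show thesis
    by (intro that[of \<psi>]) (simp_all add: \<psi> C2_junction_def)
qed


section \<open>The critical slope at the end of a half-line\<close>

text \<open>
  The notion is applied to the restrictions \<open>\<lambda>x. v (edge i x)\<close>; it leaves out the end point \<open>0\<close>.
\<close>

definition interior_supersolution ::
  "(real \<Rightarrow> real \<Rightarrow> real \<Rightarrow> real) \<Rightarrow> (real \<Rightarrow> real) \<Rightarrow> bool" where
  "interior_supersolution G w \<longleftrightarrow>
     (\<forall>g d x. C2_halfline g \<longrightarrow> x < 0 \<longrightarrow> (g has_real_derivative d) (at x) \<longrightarrow>
        local_min (\<lambda>t. w t - g t) x \<longrightarrow> G x (w x) d \<ge> 0)"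

text \<open>
  The slopes of linear test functions that touch \<open>w\<close> from below at the end point.  They form an
  up-set whose infimum, possibly infinite, is the critical slope.
\<close>

definition supports_at_0 :: "(real \<Rightarrow> real) \<Rightarrow> real \<Rightarrow> bool" where
  "supports_at_0 w q \<longleftrightarrow> (\<forall>\<^sub>F x in at_left 0. w 0 + q * x \<le> w x)"

lemma supports_at_0_mono:
  assumes "supports_at_0 w q" "q \<le> q'"
  shows "supports_at_0 w q'"
proof -
  have "\<forall>\<^sub>F x in at_left (0::real). x < 0"
    by (simp add: eventually_at_filter)
  with assms(1) show ?thesis
    unfolding supports_at_0_def
  proof eventually_elim
    case (elim x)
    then have "q' * x \<le> q * x"
      using assms(2) by (intro mult_right_mono_neg) auto
    with elim show ?case by linarith
  qed
qed

lemma negative_near_end_point: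
  fixes G :: "real \<Rightarrow> real \<Rightarrow> real \<Rightarrow> real"
  assumes "continuous_on ({..0} \<times> UNIV \<times> UNIV) (\<lambda>(x, u, p). G x u p)" "G 0 u p < 0"
  obtains d where "d > 0"
    "\<And>x u' p'. x \<le> 0 \<Longrightarrow> \<bar>x\<bar> < d \<Longrightarrow> \<bar>u' - u\<bar> < d \<Longrightarrow> \<bar>p' - p\<bar> < d \<Longrightarrow> G x u' p' < 0"
proof -
  obtain e where e: "e > 0" "\<And>z. z \<in> {..0} \<times> UNIV \<times> UNIV \<Longrightarrow> dist z (0, u, p) < e \<Longrightarrow>
     dist ((\<lambda>(x, u, p). G x u p) z) (G 0 u p) < - G 0 u p"
    using assms(1)[unfolded continuous_on_iff, rule_format, of "(0, u, p)" "- G 0 u p"] assms(2)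
    by auto
  have "G x u' p' < 0"
    if "x \<le> 0" "\<bar>x\<bar> < e / 3" "\<bar>u' - u\<bar> < e / 3" "\<bar>p' - p\<bar> < e / 3" for x u' p'
  proof -
    have "dist (x, u', p') (0, u, p) \<le> \<bar>x\<bar> + dist (u', p') (u, p)"
      by (simp add: dist_Pair_Pair[of x] dist_real_def order_trans[OF sqrt_sum_squares_le_sum_abs])
    also have "dist (u', p') (u, p) \<le> \<bar>u' - u\<bar> + \<bar>p' - p\<bar>"
      using sqrt_sum_squares_le_sum_abs[of "\<bar>u' - u\<bar>" "\<bar>p' - p\<bar>"]
      by (simp add: dist_Pair_Pair dist_real_def)
    finally have "dist (x, u', p') (0, u, p) < e"
      using that by simp
    then show ?thesis
      using e(2)[of "(x, u', p')"] that(1) by (simp add: dist_real_def)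
  qed
  with e(1) show thesis
    by (intro that[of "e / 3"]) auto
qed

text \<open>
  A critical slope \<open>m\<close> at which \<open>G\<close> is negative is impossible.  Lines of slope slightly above \<open>m\<close>
  stay below \<open>w\<close>, whereas a line of slope slightly below \<open>m\<close> lies strictly above \<open>w\<close> at points
  arbitrarily close to \<open>0\<close>.  A parabola that bends from the lower slope at \<open>0\<close> to a higher one
  leads to a negative minimum of the difference in the interior of a short interval, where the
  super-solution property contradicts the sign of \<open>G\<close>.
\<close>

lemma support_slope_improves:
  assumes super: "interior_supersolution G w" and lsc: "lower_semicontinuous w"
    and cont: "continuous_on ({..0} \<times> UNIV \<times> UNIV) (\<lambda>(x, u, p). G x u p)"
    and above: "\<And>q. q > m \<Longrightarrow> supports_at_0 w q"
    and neg: "G 0 (w 0) m < 0"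
  shows "\<exists>q<m. supports_at_0 w q"
proof (rule ccontr)
  assume "\<not> ?thesis"
  then have below: "\<And>q. q < m \<Longrightarrow> \<not> supports_at_0 w q"
    by blast
  obtain d where d: "d > 0" "\<And>x u p. x \<le> 0 \<Longrightarrow> \<bar>x\<bar> < d \<Longrightarrow> \<bar>u - w 0\<bar> < d \<Longrightarrow> \<bar>p - m\<bar> < d
      \<Longrightarrow> G x u p < 0"
    using negative_near_end_point[OF cont neg] by blast
  \<comment> \<open>The parabola below has slopes between \<open>m - 2 * e\<close> and \<open>m + 6 * e\<close>, within \<open>d\<close> of \<open>m\<close>.\<close>
  define e where "e = d / 10"
  have e: "e > 0" using d by (simp add: e_def)
  obtain b where b: "b < 0" "\<And>x. b < x \<Longrightarrow> x < 0 \<Longrightarrow> w 0 + (m + e) * x \<le> w x"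
    using above[of "m + e"] e unfolding supports_at_0_def eventually_at_left_field by auto
  \<comment> \<open>\<open>C\<close> bounds all slopes in play, so on an interval of length \<open>r < d / C\<close> the value of \<open>w\<close>
    at the contact point differs from \<open>w 0\<close> by less than \<open>d\<close>.\<close>
  define C where "C = \<bar>m\<bar> + 10 * e"
  have C: "C > 0" using e by (simp add: C_def add_nonneg_pos)
  define r where "r = min (- b / 2) (min (d / 2) (d / (2 * C)))"
  have r: "r > 0" "b < - r" "r < d"
    using b d C by (auto simp: r_def min_less_iff_disj)
  have "r \<le> d / (2 * C)"
    by (simp add: r_def)
  then have rC: "C * r < d"
    using C d(1) by (simp add: field_simps)
  \<comment> \<open>The quadratic coefficient puts \<open>h\<close> at \<open>- r\<close> on the line of slope \<open>m + 2 * e\<close>, strictly below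
    the supporting line of slope \<open>m + e\<close>.  On \<open>{- r / 4..0}\<close> the quadratic term is still small
    enough for \<open>h\<close> to stay above the line of slope \<open>m - e\<close>, below which \<open>w\<close> dips at some \<open>y\<close>.\<close>
  define h where "h x = w 0 + (m - 2 * e) * x + (- 4 * e / r) * x\<^sup>2" for x
  have h': "(h has_real_derivative (m - 2 * e - 8 * e / r * x)) (at x)" for x
    unfolding h_def using r by (auto intro!: derivative_eq_intros)
  have "\<exists>y. - r / 4 < y \<and> y < 0 \<and> w y < w 0 + (m - e) * y"
  proof -
    have "\<not> supports_at_0 w (m - e)"
      using below e by simp
    moreover have "- r / 4 < 0"
      using r by simp
    ultimately show ?thesis
      unfolding supports_at_0_def eventually_at_left_field by (meson not_le)
  qed
  then obtain y where y: "- r / 4 < y" "y < 0" "w y < w 0 + (m - e) * y"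
    by blast
  have "lower_semicontinuous (\<lambda>x. w x - h x)"
    unfolding h_def by (intro lower_semicontinuous_diff_continuous lsc continuous_intros)
  then obtain z where z: "z \<in> {-r..0}" "\<And>x. x \<in> {-r..0} \<Longrightarrow> w z - h z \<le> w x - h x"
    using lower_semicontinuous_attains_inf[of "\<lambda>x. w x - h x" "{-r..0}"] r by auto
  have "w y - h y < 0"
  proof -
    have "0 < (- y) * (e * (r + 4 * y))"
      using y e by (intro mult_pos_pos) auto
    then have "0 < (- y) * (e * (r + 4 * y)) / r"
      using r(1) by (rule divide_pos_pos)
    also have "\<dots> = h y - (w 0 + (m - e) * y)"
      using r by (simp add: h_def field_simps power2_eq_square)
    finally show ?thesis
      using y(3) by simp
  qed
  then have zneg: "w z - h z < 0"
    using z(2)[of y] y r by simp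
  have "w (- r) - h (- r) > 0"
  proof -
    have "h (- r) = w 0 - (m + 2 * e) * r"
      using r by (simp add: h_def field_simps power2_eq_square)
    moreover have "e * r > 0"
      using e r by simp
    ultimately show ?thesis
      using b(2)[of "- r"] r by (simp add: algebra_simps)
  qed
  moreover have "w 0 - h 0 = 0"
    by (simp add: h_def)
  ultimately have zin: "- r < z" "z < 0"
    using z(1) zneg by (auto simp: less_le)
  have "local_min (\<lambda>t. w t - h t) z"
    unfolding local_min_def
    using eventually_nhds_in_open[of "{-r<..<0}" z] zin z(2)
    by (auto elim!: eventually_mono)
  then have ge: "G z (w z) (m - 2 * e - 8 * e / r * z) \<ge> 0"
    using super C2_halfline_quadratic h' zin
    unfolding interior_supersolution_def h_def by blast
  \<comment> \<open>The relative position of the contact point in the interval.\<close>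
  define \<tau> where "\<tau> = - z / r"
  have "0 \<le> \<tau>" "\<tau> \<le> 1"
    using zin r(1) by (simp_all add: \<tau>_def field_simps)
  then have \<tau>: "0 \<le> e * \<tau>" "e * \<tau> \<le> e"
    using e by (simp_all add: mult_left_le)
  have slope: "\<bar>(m - 2 * e - 8 * e / r * z) - m\<bar> < d"
  proof -
    have "8 * e / r * z = - 8 * (e * \<tau>)"
      using r(1) by (simp add: \<tau>_def)
    moreover have "d = 10 * e"
      by (simp add: e_def)
    ultimately show ?thesis
      using \<tau> e by linarith
  qed
  have near_w0: "\<bar>w z - w 0\<bar> < d"
  proof -
    have "w 0 + (m + e) * z \<le> w z"
      using b(2) zin r by simp
    moreover have "h z = w 0 + (m - 2 * e + 4 * (e * \<tau>)) * z"
      using r(1) by (simp add: h_def \<tau>_def field_simps power2_eq_square)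
    then have "w z - w 0 < (m - 2 * e + 4 * (e * \<tau>)) * z"
      using zneg by simp
    moreover have "\<bar>(m + e) * z\<bar> < d"
    proof -
      have "\<bar>(m + e) * z\<bar> \<le> C * r"
        unfolding abs_mult using zin e C by (intro mult_mono) (auto simp: C_def)
      with rC show ?thesis by simp
    qed
    moreover have "\<bar>(m - 2 * e + 4 * (e * \<tau>)) * z\<bar> < d"
    proof -
      have "\<bar>m - 2 * e + 4 * (e * \<tau>)\<bar> \<le> C"
        using \<tau> e unfolding C_def by linarith
      then have "\<bar>(m - 2 * e + 4 * (e * \<tau>)) * z\<bar> \<le> C * r"
        unfolding abs_mult using zin C by (intro mult_mono) auto
      with rC show ?thesis by simp
    qed
    ultimately show ?thesis
      by linarith
  qed
  have "G z (w z) (m - 2 * e - 8 * e / r * z) < 0"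
    using zin r slope near_w0 by (intro d(2)) auto
  with ge show False by simp
qed

text \<open>
  Otherwise the critical slope would be finite and lie between \<open>a\<close> and \<open>p\<close>, where \<open>G\<close> is negative.
\<close>

lemma support_slope_below_negative_interval:
  assumes super: "interior_supersolution G w" and lsc: "lower_semicontinuous w"
    and cont: "continuous_on ({..0} \<times> UNIV \<times> UNIV) (\<lambda>(x, u, p). G x u p)"
    and above: "\<And>q. q > p \<Longrightarrow> supports_at_0 w q"
    and neg: "\<And>q. a \<le> q \<Longrightarrow> q \<le> p \<Longrightarrow> G 0 (w 0) q < 0"
  shows "\<exists>q<a. supports_at_0 w q"
proof (rule ccontr)
  assume "\<not> ?thesis"
  then have lower: "\<And>q. supports_at_0 w q \<Longrightarrow> a \<le> q"
    by (meson not_le)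
  define m where "m = Inf {q. supports_at_0 w q}"
  have bdd: "bdd_below {q. supports_at_0 w q}"
    using lower by (auto simp: bdd_below_def)
  have ne: "{q. supports_at_0 w q} \<noteq> {}"
    using above[of "p + 1"] by auto
  have "a \<le> m"
    unfolding m_def using ne lower by (intro cInf_greatest) auto
  moreover have "m \<le> p"
  proof (rule field_le_epsilon)
    fix e :: real assume "e > 0"
    then show "m \<le> p + e"
      unfolding m_def using above by (intro cInf_lower bdd) simp
  qed
  moreover have "supports_at_0 w q" if "q > m" for q
  proof -
    obtain q' where "supports_at_0 w q'" "q' < q"
      using \<open>q > m\<close> cInf_less_iff[OF ne bdd, of q] by (auto simp: m_def)
    then show ?thesis
      by (intro supports_at_0_mono[of w q' q]) auto
  qed
  ultimately obtain q where "q < m" "supports_at_0 w q"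
    using support_slope_improves[OF super lsc cont, of m] neg by blast
  then show False
    using cInf_lower[OF _ bdd, of q] by (simp add: m_def)
qed


section \<open>Test functions at the vertex\<close>

text \<open>
  A test function on one edge extends to the junction by its value at the vertex, which makes the
  one-dimensional theory applicable to the restrictions of a super-solution.
\<close>

lemma interior_supersolution_edge:
  fixes F :: "'k::finite \<Rightarrow> real \<Rightarrow> real \<Rightarrow> real \<Rightarrow> real"
  assumes "viscosity_supersolution F B v"
  shows "interior_supersolution (F i) (\<lambda>x. v (edge i x))"
  unfolding interior_supersolution_def
proof (intro allI impI)
  fix g d x
  assume g: "C2_halfline g" "(g has_real_derivative d) (at x)" and x: "x < 0"
    and min: "local_min (\<lambda>t. v (edge i t) - g t) x"
  define h where "h j = (if j = i then g else (\<lambda>x. g 0))" for j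
  have "C2_halfline (h j)" for j
    using g(1) C2_halfline_quadratic[of "g 0" 0 0] by (simp add: h_def)
  moreover have "h j 0 = g 0" for j
    by (simp add: h_def)
  ultimately obtain \<psi> where \<psi>: "C2_junction \<psi>" "\<And>j x. x \<le> 0 \<Longrightarrow> \<psi> (edge j x) = h j x"
    using C2_junction_of_edges by blast
  have \<psi>i: "\<psi> (edge i x) = g x" if "x \<le> 0" for x
    using \<psi>(2)[OF that, of i] by (simp add: h_def)
  have "((\<lambda>t. \<psi> (edge i t)) has_real_derivative d) (at x within {..0})"
    by (rule has_field_derivative_transform_within[of g _ _ _ 1])
      (use g(2) x \<psi>i in \<open>auto intro: has_field_derivative_at_within\<close>)
  then have deriv: "edge_deriv \<psi> i x = d"
    using x by (intro edge_deriv_unique) auto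
  have neg: "\<forall>\<^sub>F t in nhds x. t \<in> {..<0}"
    using x by (intro eventually_nhds_in_open) auto
  have "\<forall>\<^sub>F t in nhds x. v (edge i x) - \<psi> (edge i x) \<le> v (edge i t) - \<psi> (edge i t)"
    using min neg unfolding local_min_def
    by eventually_elim (use x in \<open>simp add: \<psi>i\<close>)
  then have "local_min (\<lambda>p. v p - \<psi> p) (edge i x)"
    using x by (simp add: local_min_def eventually_nhds_edge_interior)
  then show "0 \<le> F i x (v (edge i x)) d"
    using assms \<psi>(1) x deriv unfolding viscosity_supersolution_def by blast
qed

text \<open>
  The strict inequality absorbs the first-order remainder of \<open>\<phi>\<close>.
\<close>

lemma local_min_vertex_supports:
  fixes v :: "'k::finite junction \<Rightarrow> real"
  assumes "C2_junction \<phi>" "local_min (\<lambda>x. v x - \<phi> x) vertex" "q > edge_deriv \<phi> i 0"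
  shows "supports_at_0 (\<lambda>x. v (edge i x)) q"
proof -
  have "((\<lambda>t. \<phi> (edge i t)) has_real_derivative edge_deriv \<phi> i 0) (at 0 within {..0})"
    by (rule edge_deriv_has_derivative[OF assms(1)]) simp
  then have "((\<lambda>t. \<phi> (edge i t)) has_real_derivative edge_deriv \<phi> i 0) (at_left 0)"
    by (rule has_field_derivative_subset) auto
  then have "((\<lambda>t. (\<phi> (edge i t) - \<phi> vertex) / t) \<longlongrightarrow> edge_deriv \<phi> i 0) (at_left 0)"
    by (simp add: has_field_derivative_iff)
  then have "\<forall>\<^sub>F t in at_left 0. (\<phi> (edge i t) - \<phi> vertex) / t < q"
    using assms(3) by (rule order_tendstoD)
  moreover have "\<forall>\<^sub>F t in at_left 0. v vertex - \<phi> vertex \<le> v (edge i t) - \<phi> (edge i t)"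
    using assms(2) by (auto simp: local_min_def eventually_nhds_vertex)
  moreover have "\<forall>\<^sub>F t in at_left (0::real). t < 0"
    by (simp add: eventually_at_filter)
  ultimately show ?thesis
    unfolding supports_at_0_def
    by eventually_elim (simp add: field_simps)
qed

lemma replace_slope_at_vertex:
  fixes v :: "'k::finite junction \<Rightarrow> real"
  assumes "C2_junction \<phi>" "local_min (\<lambda>x. v x - \<phi> x) vertex"
    and "supports_at_0 (\<lambda>x. v (edge i x)) q"
  obtains \<psi> where "C2_junction \<psi>" "local_min (\<lambda>x. v x - \<psi> x) vertex"
    "\<And>j. edge_deriv \<psi> j 0 = (if j = i then q else edge_deriv \<phi> j 0)"
proof -
  define g where "g j = (if j = i then (\<lambda>x. \<phi> vertex + q * x) else (\<lambda>x. \<phi> (edge j x)))" for j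
  have "C2_halfline (g j)" for j
    using assms(1) C2_halfline_quadratic[of "\<phi> vertex" q 0] by (simp add: g_def C2_junction_def)
  moreover have "g j 0 = \<phi> vertex" for j
    by (simp add: g_def)
  ultimately obtain \<psi> where \<psi>: "C2_junction \<psi>" "\<And>j x. x \<le> 0 \<Longrightarrow> \<psi> (edge j x) = g j x"
    using C2_junction_of_edges by blast
  have \<psi>v: "\<psi> vertex = \<phi> vertex"
    using \<psi>(2)[of 0 i] by (simp add: g_def)
  have "edge_deriv \<psi> j 0 = (if j = i then q else edge_deriv \<phi> j 0)" for j
  proof (rule edge_deriv_unique)
    have "(g j has_real_derivative (if j = i then q else edge_deriv \<phi> j 0)) (at 0 within {..0})"
      using edge_deriv_has_derivative[OF assms(1), of 0 j]
      by (auto simp: g_def intro!: derivative_eq_intros)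
    then show "((\<lambda>t. \<psi> (edge j t)) has_real_derivative (if j = i then q else edge_deriv \<phi> j 0))
        (at 0 within {..0})"
      by (rule has_field_derivative_transform_within[of _ _ _ _ 1]) (simp_all add: \<psi>(2))
  qed simp
  moreover have "\<forall>\<^sub>F t in at_left 0. v vertex - \<psi> vertex \<le> v (edge j t) - \<psi> (edge j t)" for j
  proof -
    have neg: "\<forall>\<^sub>F t in at_left (0::real). t < 0"
      by (simp add: eventually_at_filter)
    show ?thesis
    proof (cases "j = i")
      case True
      show ?thesis
        using assms(3) neg unfolding supports_at_0_def
        by eventually_elim (use True in \<open>simp add: \<psi>(2) \<psi>v g_def\<close>)
    next
      case False
      have "\<forall>\<^sub>F t in at_left 0. v vertex - \<phi> vertex \<le> v (edge j t) - \<phi> (edge j t)"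
        using assms(2) by (auto simp: local_min_def eventually_nhds_vertex)
      then show ?thesis
        using neg by eventually_elim (use False in \<open>simp add: \<psi>(2) \<psi>v g_def\<close>)
    qed
  qed
  then have "local_min (\<lambda>x. v x - \<psi> x) vertex"
    by (simp add: local_min_def eventually_nhds_vertex)
  ultimately show thesis
    using \<psi>(1) that by blast
qed

text \<open>
  The existential form of the relaxed condition; the supremum is attained, so the two agree.
\<close>

lemma relaxed_condition_if_supersolution:
  fixes F :: "'k::finite \<Rightarrow> real \<Rightarrow> real \<Rightarrow> real \<Rightarrow> real"
  assumes cont: "\<And>i. continuous_on ({..0} \<times> UNIV \<times> UNIV) (\<lambda>(x, u, p). F i x u p)"
    and super: "viscosity_supersolution F B v"
    and \<phi>: "C2_junction \<phi>" "local_min (\<lambda>x. v x - \<phi> x) vertex"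
  defines "s \<equiv> max ((\<Sum>j\<in>UNIV. edge_deriv \<phi> j 0) - B) 0"
  shows "\<exists>i. \<exists>\<theta>\<in>{0..1}. F i 0 (v vertex) (edge_deriv \<phi> i 0 - \<theta> * s) \<ge> 0"
proof (rule ccontr)
  assume "\<not> ?thesis"
  then have neg: "F i 0 (v vertex) (edge_deriv \<phi> i 0 - \<theta> * s) < 0" if "0 \<le> \<theta>" "\<theta> \<le> 1" for i \<theta>
    using that by (metis atLeastAtMost_iff not_le)
  have s: "s \<ge> 0" "(\<Sum>j\<in>UNIV. edge_deriv \<phi> j 0) - B \<le> s"
    by (simp_all add: s_def)
  \<comment> \<open>Any edge will do: lowering a single slope suffices.\<close>
  define i :: 'k where "i = undefined"
  define p where "p = edge_deriv \<phi> i 0"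
  define w where "w x = v (edge i x)" for x
  have w0: "w 0 = v vertex"
    by (simp add: w_def)
  have lsc: "lower_semicontinuous w"
    unfolding w_def using super[unfolded viscosity_supersolution_def, THEN conjunct1]
    by (rule lower_semicontinuous_compose) (rule continuous_on_edge)
  have isup: "interior_supersolution (F i) w"
    unfolding w_def using super by (rule interior_supersolution_edge)
  have "F i 0 (w 0) q < 0" if q: "p - s \<le> q" "q \<le> p" for q
  proof (cases "s = 0")
    case True
    then show ?thesis using q neg[of 0 i] by (simp add: w0 p_def)
  next
    case False
    then have "q = p - (p - q) / s * s" "0 \<le> (p - q) / s" "(p - q) / s \<le> 1"
      using q s by (auto simp: field_simps)
    then show ?thesis
      using neg[of "(p - q) / s" i] by (simp add: w0 p_def)
  qed
  moreover have "supports_at_0 w q" if "q > p" for q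
    unfolding w_def using that by (intro local_min_vertex_supports[OF \<phi>]) (simp add: p_def)
  ultimately obtain q1 where q1: "q1 < p - s" "supports_at_0 w q1"
    using support_slope_below_negative_interval[OF isup lsc cont, of p "p - s"] by blast
  obtain d where d: "d > 0" "\<And>x u q. x \<le> 0 \<Longrightarrow> \<bar>x\<bar> < d \<Longrightarrow> \<bar>u - v vertex\<bar> < d \<Longrightarrow>
      \<bar>q - (p - s)\<bar> < d \<Longrightarrow> F i x u q < 0"
    using negative_near_end_point[OF cont, of i "v vertex" "p - s"] neg[of 1 i]
    by (auto simp: p_def)
  \<comment> \<open>The slope \<open>q1\<close> may be far below \<open>p - s\<close>, where nothing is known about \<open>F i\<close>; moving up towards
    \<open>p - s\<close> keeps the support and restores the sign.\<close>
  define q where "q = max q1 (p - s - d / 2)"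
  have q: "q < p - s" "\<bar>q - (p - s)\<bar> < d" "q1 \<le> q"
    using q1 d(1) by (auto simp: q_def max_def)
  have "supports_at_0 w q"
    using q1(2) q(3) by (rule supports_at_0_mono)
  then obtain \<psi> where \<psi>: "C2_junction \<psi>" "local_min (\<lambda>x. v x - \<psi> x) vertex"
    "\<And>j. edge_deriv \<psi> j 0 = (if j = i then q else edge_deriv \<phi> j 0)"
    using replace_slope_at_vertex[OF \<phi>, of i q] unfolding w_def by blast
  have "F j 0 (v vertex) (edge_deriv \<psi> j 0) < 0" for j
    using d(2)[of 0 "v vertex" q] d(1) q(2) neg[of 0 j] by (simp add: \<psi>(3))
  then have "(MAX j. F j 0 (v vertex) (edge_deriv \<psi> j 0)) < 0"
    by (subst Max_less_iff) auto
  moreover have "(\<Sum>j\<in>UNIV. edge_deriv \<psi> j 0) - B < 0"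
  proof -
    have "(\<Sum>j\<in>UNIV. edge_deriv \<psi> j 0) = q + (\<Sum>j\<in>UNIV - {i}. edge_deriv \<phi> j 0)"
      by (simp add: \<psi>(3) sum.remove[of UNIV i])
    moreover have "(\<Sum>j\<in>UNIV. edge_deriv \<phi> j 0) = p + (\<Sum>j\<in>UNIV - {i}. edge_deriv \<phi> j 0)"
      by (simp add: p_def sum.remove[of UNIV i])
    ultimately show ?thesis
      using q(1) s(2) by simp
  qed
  moreover have "max ((\<Sum>j\<in>UNIV. edge_deriv \<psi> j 0) - B)
      (MAX j. F j 0 (v vertex) (edge_deriv \<psi> j 0)) \<ge> 0"
    using super \<psi>(1,2) unfolding viscosity_supersolution_def by blast
  ultimately show False
    by linarith
qed

theorem proposition12:
  fixes F :: "'k::finite \<Rightarrow> real \<Rightarrow> real \<Rightarrow> real \<Rightarrow> real"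
    and B :: real
    and v :: "'k junction \<Rightarrow> real"
  assumes "\<And>i. continuous_on ({..0} \<times> UNIV \<times> UNIV) (\<lambda>(x, u, p). F i x u p)"
    and "lower_semicontinuous v"
  shows "viscosity_supersolution F B v \<longleftrightarrow>
    (\<forall>\<phi> x\<^sub>0. C2_junction \<phi> \<longrightarrow> local_min (\<lambda>x. v x - \<phi> x) x\<^sub>0 \<longrightarrow>
       (\<forall>i x. x < 0 \<longrightarrow> x\<^sub>0 = edge i x \<longrightarrow> F i x (v x\<^sub>0) (edge_deriv \<phi> i x) \<ge> 0) \<and>
       (x\<^sub>0 = vertex \<longrightarrow>
          (SUP (i, \<theta>) \<in> UNIV \<times> {0..1}.
             F i 0 (v vertex)
               (edge_deriv \<phi> i 0 - \<theta> * max ((\<Sum>j\<in>UNIV. edge_deriv \<phi> j 0) - B) 0)) \<ge> 0))"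
proof -
  have relaxed_iff: "(SUP (i, \<theta>) \<in> UNIV \<times> {0..1}. F i 0 u (p i - \<theta> * s)) \<ge> 0 \<longleftrightarrow>
      (\<exists>i. \<exists>\<theta>\<in>{0..1}. F i 0 u (p i - \<theta> * s) \<ge> 0)" for u s and p :: "'k \<Rightarrow> real"
  proof -
    obtain z where z: "z \<in> UNIV \<times> {0..1}"
        "(case z of (i, \<theta>) \<Rightarrow> F i 0 u (p i - \<theta> * s)) =
           (SUP (i, \<theta>) \<in> UNIV \<times> {0..1}. F i 0 u (p i - \<theta> * s))"
        "\<And>z'. z' \<in> UNIV \<times> {0..1} \<Longrightarrow> (case z' of (i, \<theta>) \<Rightarrow> F i 0 u (p i - \<theta> * s)) \<le>
           (case z of (i, \<theta>) \<Rightarrow> F i 0 u (p i - \<theta> * s))"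
      using SUP_attained[of F u p s, OF assms(1)] by blast
    show ?thesis
      unfolding z(2)[symmetric]
    proof
      assume "(case z of (i, \<theta>) \<Rightarrow> F i 0 u (p i - \<theta> * s)) \<ge> 0"
      then show "\<exists>i. \<exists>\<theta>\<in>{0..1}. F i 0 u (p i - \<theta> * s) \<ge> 0"
        using z(1) by (cases z) (simp add: mem_Times_iff del: atLeastAtMost_iff, blast)
    next
      assume "\<exists>i. \<exists>\<theta>\<in>{0..1}. F i 0 u (p i - \<theta> * s) \<ge> 0"
      then obtain i \<theta> where "\<theta> \<in> {0..1}" "F i 0 u (p i - \<theta> * s) \<ge> 0"
        by blast
      with z(3)[of "(i, \<theta>)"] show "(case z of (i, \<theta>) \<Rightarrow> F i 0 u (p i - \<theta> * s)) \<ge> 0"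
        by (simp add: mem_Times_iff)
    qed
  qed
  have max_iff: "max c (MAX i. F i 0 u (p i)) \<ge> 0 \<longleftrightarrow> c \<ge> 0 \<or> (\<exists>i. F i 0 u (p i) \<ge> 0)"
    for c u and p :: "'k \<Rightarrow> real"
    by (auto simp: le_max_iff_disj Max_ge_iff)
  have kirchhoff_if_relaxed: "c \<ge> 0 \<or> (\<exists>i. F i 0 u (p i) \<ge> 0)"
    if "\<exists>i. \<exists>\<theta>\<in>{0..1}. F i 0 u (p i - \<theta> * max c 0) \<ge> 0" for c u and p :: "'k \<Rightarrow> real"
    using that by (cases "c \<ge> 0") (auto simp: max_def)
  show ?thesis (is "_ = ?relaxed")
  proof
    assume super: "viscosity_supersolution F B v"
    show ?relaxed
      unfolding relaxed_iff
    proof (intro allI impI conjI)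
      fix \<phi> x\<^sub>0 i x
      assume "C2_junction \<phi>" "local_min (\<lambda>x. v x - \<phi> x) x\<^sub>0" "x < 0" "x\<^sub>0 = edge i x"
      then show "F i x (v x\<^sub>0) (edge_deriv \<phi> i x) \<ge> 0"
        using super unfolding viscosity_supersolution_def by blast
    next
      fix \<phi> x\<^sub>0
      assume "C2_junction \<phi>" "local_min (\<lambda>x. v x - \<phi> x) x\<^sub>0" "x\<^sub>0 = vertex"
      then show "\<exists>i. \<exists>\<theta>\<in>{0..1}. F i 0 (v vertex)
          (edge_deriv \<phi> i 0 - \<theta> * max ((\<Sum>j\<in>UNIV. edge_deriv \<phi> j 0) - B) 0) \<ge> 0"
        using relaxed_condition_if_supersolution[OF assms(1) super] by simp
    qed
  next
    assume R: ?relaxed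
    show "viscosity_supersolution F B v"
      unfolding viscosity_supersolution_def max_iff
    proof (intro conjI assms(2) allI impI)
      fix \<phi> x\<^sub>0 i x
      assume "C2_junction \<phi>" "local_min (\<lambda>x. v x - \<phi> x) x\<^sub>0" "x < 0" "x\<^sub>0 = edge i x"
      then show "F i x (v x\<^sub>0) (edge_deriv \<phi> i x) \<ge> 0"
        using R by blast
    next
      fix \<phi> x\<^sub>0
      assume "C2_junction \<phi>" "local_min (\<lambda>x. v x - \<phi> x) x\<^sub>0" "x\<^sub>0 = vertex"
      then have "\<exists>i. \<exists>\<theta>\<in>{0..1}. F i 0 (v vertex)
          (edge_deriv \<phi> i 0 - \<theta> * max ((\<Sum>j\<in>UNIV. edge_deriv \<phi> j 0) - B) 0) \<ge> 0"
        using R unfolding relaxed_iff by blast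
      then show "(\<Sum>j\<in>UNIV. edge_deriv \<phi> j 0) - B \<ge> 0 \<or>
          (\<exists>i. F i 0 (v vertex) (edge_deriv \<phi> i 0) \<ge> 0)"
        by (rule kirchhoff_if_relaxed)
    qed
  qed
qed

end
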